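(* Let $H$ be a monoid (not necessarily commutative or cancellative). If $H$ is atomic and l.f.g.u., then $H$ is FmF.
   Context: Let $H$ be a multiplicatively written monoid with identity $1_H$. Units and atoms. $H^\times$ is the group of units of $H$ (elements with a two-sided inverse). An atom of $H$ is an element $a \in H \setminus H^\times$ such that $a \ne xy$ for all $x,y \in H\setminus H^\times$; $\mathscr A(H)$ is the set of atoms. Write $x \simeq_H y$ if $x \in H^\times y H^\times$, and $x \mid_H y$ if $y = uxv$ for some $u,v \in H$. Generation. For $X \subseteq H$, $\mathrm{Sgp}\langle X\rangle_H$ is the subsemigroup generated by $X$, i.e. the set of all products $x_1\cdots x_n$ with $n \ge 1$ and $x_i \in X$ (empty if $X=\emptyset$). $H$ is f.g.u. (finitely generated up to units) if there is a finite set $A \subseteq H$ with $H\setminus H^\times \subseteq \mathrm{Sgp}\langle H^\times A H^\times\rangle_H$, where $H^\times A H^\times = \{uav : u,v\in H^\times, a \in A\}$. A submonoid $M$ of $H$ is divisor-closed if $x \mid_H y$ and $y\in M$ imply $x \in M$. For $x\in H$, $\langle\langle x\rangle\rangle_H$ is the smallest divisor-closed submonoid of $H$ containing $x$. $H$ is l.f.g.u. (locally finitely generated up to units) if the monoid $\langle\langle x\rangle\rangle_H$ is f.g.u. for every $x\in H$. Factorizations. $\mathscr F(\mathscr A(H))$ is the free monoid on the set $\mathscr A(H)$, with operation $\ast$ (concatenation), empty word $\varepsilon$, and word length $\|\cdot\|$; $\pi_H:\mathscr F(\mathscr A(H))\to H$ is the monoid homomorphism with $\pi_H(a)=a$ for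 all $a\in\mathscr A(H)$. For $x\in H$, $\mathcal Z_H(x) := \{\mathfrak a\in\mathscr F(\mathscr A(H)) : \pi_H(\mathfrak a)=x\}$ is the set of factorizations of $x$. $H$ is atomic if $\mathcal Z_H(x)\neq\emptyset$ for every $x\in H\setminus H^\times$. $\mathscr C_H$ is the congruence on $\mathscr F(\mathscr A(H))$ with $\mathfrak a \equiv\mathfrak b \bmod \mathscr C_H$ iff either $\mathfrak a=\mathfrak b=\varepsilon$, or $\mathfrak a=a_1\ast\cdots\ast a_n$ and $\mathfrak b=b_1\ast\cdots\ast b_n$ have the same length $n\ge1$, $\pi_H(\mathfrak a)=\pi_H(\mathfrak b)$, and there is a permutation $\sigma$ of $\{1,\dots,n\}$ with $a_i\simeq_H b_{\sigma(i)}$ for all $i$. $\preceq_H$ is the preorder on $\mathscr F(\mathscr A(H))$ with $\mathfrak a\preceq_H\mathfrak b$ iff either $\mathfrak a=\mathfrak b=\varepsilon$, or $\mathfrak a=a_1\ast\cdots\ast a_m$ and $\mathfrak b=b_1\ast\cdots\ast b_n$ with $m,n\ge1$, $\pi_H(\mathfrak a)=\pi_H(\mathfrak b)$, and there is an injection $\sigma:\{1,\dots,m\}\to\{1,\dots,n\}$ with $a_i\simeq_H b_{\sigma(i)}$ for all $i$. Write $\mathfrak a\prec_H\mathfrak b$ if $\mathfrak a\preceq_H\mathfrak b$ and $\mathfrak b\not\preceq_H\mathfrak a$. A word $\mathfrak a$ is $\preceq_H$-minimal if there is no $\mathfrak b\in\mathscr F(\mathscr A(H))$ with $\mathfrak b\prec_H\mathfrak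 a$. $\mathcal Z_H^{\sf m}(x)$ is the set of $\preceq_H$-minimal elements $\mathfrak a \in\mathcal Z_H(x)$, and $\mathsf Z_H^{\sf m}(x)$ is the set of $\mathscr C_H$-classes of elements of $\mathcal Z_H^{\sf m}(x)$. $H$ is FmF if $H$ is atomic and $\mathsf Z_H^{\sf m}(x)$ is finite for every $x\in H$. *)

theory Defs
  imports "HOL-Algebra.Group"
begin

definition assoc_units :: "('a, 'b) monoid_scheme \<Rightarrow> 'a \<Rightarrow> 'a \<Rightarrow> bool" where
  "assoc_units H x y \<longleftrightarrow> (\<exists>u\<in>Units H. \<exists>v\<in>Units H. x = u \<otimes>\<^bsub>H\<^esub> y \<otimes>\<^bsub>H\<^esub> v)"

text \<open>Two-sided divisibility; the library's \<open>factor\<close> relation only allows a cofactor on the right.\<close>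

definition divides2 :: "('a, 'b) monoid_scheme \<Rightarrow> 'a \<Rightarrow> 'a \<Rightarrow> bool" where
  "divides2 H x y \<longleftrightarrow> (\<exists>u\<in>carrier H. \<exists>v\<in>carrier H. y = u \<otimes>\<^bsub>H\<^esub> x \<otimes>\<^bsub>H\<^esub> v)"

definition atoms :: "('a, 'b) monoid_scheme \<Rightarrow> 'a set" where
  "atoms H = {a \<in> carrier H - Units H.
     \<forall>x\<in>carrier H - Units H. \<forall>y\<in>carrier H - Units H. a \<noteq> x \<otimes>\<^bsub>H\<^esub> y}"

definition word_prod :: "('a, 'b) monoid_scheme \<Rightarrow> 'a list \<Rightarrow> 'a" where
  "word_prod H w = foldr (\<lambda>x y. x \<otimes>\<^bsub>H\<^esub> y) w \<one>\<^bsub>H\<^esub>"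


subsection \<open>Finite generation up to units\<close>

definition Sgp :: "('a, 'b) monoid_scheme \<Rightarrow> 'a set \<Rightarrow> 'a set" where
  "Sgp H X = {word_prod H w | w. w \<noteq> [] \<and> set w \<subseteq> X}"

definition fgu :: "('a, 'b) monoid_scheme \<Rightarrow> bool" where
  "fgu H \<longleftrightarrow> (\<exists>A. finite A \<and> A \<subseteq> carrier H \<and>
     carrier H - Units H \<subseteq>
       Sgp H {u \<otimes>\<^bsub>H\<^esub> a \<otimes>\<^bsub>H\<^esub> v | u a v. u \<in> Units H \<and> a \<in> A \<and> v \<in> Units H})"

definition divisor_closed :: "'a set \<Rightarrow> ('a, 'b) monoid_scheme \<Rightarrow> bool" where
  "divisor_closed M H \<longleftrightarrow> submonoid M H \<and>
     (\<forall>x\<in>carrier H. \<forall>y\<in>M. divides2 H x y \<longrightarrow> x \<in> M)"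

definition div_hull :: "('a, 'b) monoid_scheme \<Rightarrow> 'a \<Rightarrow> 'a set" where
  "div_hull H x = \<Inter>{M. divisor_closed M H \<and> x \<in> M}"

lemma divisor_closed_carrier:
  assumes "monoid H"
  shows "divisor_closed (carrier H) H"
  using monoid.m_closed[OF assms] monoid.one_closed[OF assms]
  unfolding divisor_closed_def submonoid_def by blast

lemma divisor_closed_div_hull:
  assumes "monoid H" "x \<in> carrier H"
  shows "divisor_closed (div_hull H x) H"
proof -
  have sub: "div_hull H x \<subseteq> carrier H"
    using divisor_closed_carrier[OF assms(1)] assms(2) unfolding div_hull_def by blast
  have mem: "y \<in> div_hull H x \<longleftrightarrow> (\<forall>M. divisor_closed M H \<and> x \<in> M \<longrightarrow> y \<in> M)" for y
    unfolding div_hull_def by blast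
  have one: "\<one>\<^bsub>H\<^esub> \<in> div_hull H x"
    unfolding mem divisor_closed_def by (blast intro: submonoid.one_closed)
  have mult: "y \<otimes>\<^bsub>H\<^esub> z \<in> div_hull H x" if "y \<in> div_hull H x" "z \<in> div_hull H x" for y z
    using that unfolding mem divisor_closed_def by (meson submonoid.m_closed)
  have dvd: "y \<in> div_hull H x" if "y \<in> carrier H" "z \<in> div_hull H x" "divides2 H y z" for y z
    using that unfolding mem divisor_closed_def by meson
  show ?thesis
    unfolding divisor_closed_def using submonoid.intro[OF sub mult one] dvd by blast
qed

text \<open>The units in \<open>fgu\<close> below are those of the submonoid, not of \<open>H\<close>.\<close>

definition lfgu :: "('a, 'b) monoid_scheme \<Rightarrow> bool" where
  "lfgu H \<longleftrightarrow> (\<forall>x\<in>carrier H. fgu (H\<lparr>carrier := div_hull H x\<rparr>))"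


subsection \<open>Factorizations\<close>

text \<open>The free monoid on the atoms is \<open>lists (atoms H)\<close>, with concatenation as operation.\<close>

definition factorizations :: "('a, 'b) monoid_scheme \<Rightarrow> 'a \<Rightarrow> 'a list set" where
  "factorizations H x = {w \<in> lists (atoms H). word_prod H w = x}"

definition atomic :: "('a, 'b) monoid_scheme \<Rightarrow> bool" where
  "atomic H \<longleftrightarrow> (\<forall>x\<in>carrier H - Units H. factorizations H x \<noteq> {})"

definition fact_cong :: "('a, 'b) monoid_scheme \<Rightarrow> ('a list \<times> 'a list) set" where
  "fact_cong H = {(a, b). a \<in> lists (atoms H) \<and> b \<in> lists (atoms H) \<and>
     (a = [] \<and> b = [] \<or>
      1 \<le> length a \<and> length a = length b \<and> word_prod H a = word_prod H b \<and>
      (\<exists>\<sigma>. bij_betw \<sigma> {..<length a} {..<length a} \<and>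
           (\<forall>i<length a. assoc_units H (a ! i) (b ! \<sigma> i))))}"

definition fact_le :: "('a, 'b) monoid_scheme \<Rightarrow> 'a list \<Rightarrow> 'a list \<Rightarrow> bool" where
  "fact_le H a b \<longleftrightarrow> a \<in> lists (atoms H) \<and> b \<in> lists (atoms H) \<and>
     (a = [] \<and> b = [] \<or>
      1 \<le> length a \<and> 1 \<le> length b \<and> word_prod H a = word_prod H b \<and>
      (\<exists>\<sigma>. inj_on \<sigma> {..<length a} \<and> \<sigma> ` {..<length a} \<subseteq> {..<length b} \<and>
           (\<forall>i<length a. assoc_units H (a ! i) (b ! \<sigma> i))))"

definition fact_less :: "('a, 'b) monoid_scheme \<Rightarrow> 'a list \<Rightarrow> 'a list \<Rightarrow> bool" where
  "fact_less H a b \<longleftrightarrow> fact_le H a b \<and> \<not> fact_le H b a"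

definition min_factorizations :: "('a, 'b) monoid_scheme \<Rightarrow> 'a \<Rightarrow> 'a list set" where
  "min_factorizations H x =
     {a \<in> factorizations H x. \<not> (\<exists>b\<in>lists (atoms H). fact_less H b a)}"

definition min_factorization_classes :: "('a, 'b) monoid_scheme \<Rightarrow> 'a \<Rightarrow> 'a list set set" where
  "min_factorization_classes H x = min_factorizations H x // fact_cong H"

definition FmF :: "('a, 'b) monoid_scheme \<Rightarrow> bool" where
  "FmF H \<longleftrightarrow> atomic H \<and> (\<forall>x\<in>carrier H. finite (min_factorization_classes H x))"

end

theory Submission
  imports Defs Complex_Main "HOL-Combinatorics.Permutations"
begin

text \<open>
  Send a word of atoms to the multiset of the associate classes (two-sided cosets of the unit
  group) of its letters, its \<^emph>\<open>class content\<close>. Among words with the same product, the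
  preorder on factorizations is inclusion of contents and the congruence is equality of contents
  (\<open>fact_le_iff_content\<close>, \<open>fact_cong_iff_content\<close>); the empty word is comparable only with itself.
  Hence the nonempty minimal factorizations of an element have contents that form an antichain
  for inclusion, and each congruence class of minimal factorizations is determined by its content.

  The letters of every factorization of \<open>x\<close> are atoms lying in the divisor-closed hull of \<open>x\<close>.
  Take a finite set \<open>A\<close> that generates this hull up to units. An atom that is a product
  of elements is associated to one of them (\<open>atom_assoc_letter\<close>), because an atom only splits off
  units. So every atom of the hull is associated to an element of \<open>A\<close>, and the contents are
  multisets over a finite set. By Dickson's lemma (\<open>finite_antichain_multisets\<close>) an antichain of
  such multisets is finite.
\<close>


section \<open>Dickson's lemma for multisets\<close>

lemma nat_seq_incseq_subseq:
  fixes f :: "nat \<Rightarrow> nat"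
  obtains r where "strict_mono r" "incseq (f \<circ> r)"
proof -
  obtain g where g: "strict_mono g" "monoseq (\<lambda>n. f (g n))"
    using seq_monosub by blast
  show thesis
  proof (cases "incseq (\<lambda>n. f (g n))")
    case True
    then show thesis using that[of g] g(1) by (simp add: comp_def)
  next
    case False
    then have dec: "decseq (\<lambda>n. f (g n))" using g(2) by (simp add: monoseq_iff)
    \<comment> \<open>A decreasing sequence of naturals is constant from the place \<open>N\<close> where it attains its minimum.\<close>
    obtain N where N: "\<And>n. f (g N) \<le> f (g n)"
      using ex_has_least_nat[of "\<lambda>_. True" 0 "\<lambda>n. f (g n)"] by auto
    have const: "f (g (N + n)) = f (g N)" for n
      using N[of "N + n"] decseqD[OF dec, of N "N + n"] by simp
    show thesis
    proof (rule that[of "\<lambda>n. g (N + n)"])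
      show "strict_mono (\<lambda>n. g (N + n))"
        using g(1) by (simp add: strict_mono_def)
      show "incseq (f \<circ> (\<lambda>n. g (N + n)))"
        by (simp add: comp_def const)
    qed
  qed
qed

text \<open>Coordinates are made monotone one at a time: passing to a further subsequence preserves the
  monotonicity already obtained.\<close>

lemma finite_coordinates_incseq_subseq:
  fixes f :: "nat \<Rightarrow> 'k \<Rightarrow> nat"
  assumes "finite K"
  shows "\<exists>r. strict_mono r \<and> (\<forall>k\<in>K. incseq (\<lambda>n. f (r n) k))"
  using assms
proof (induction K)
  case empty
  show ?case by (intro exI[of _ id]) (simp add: strict_mono_def monotone_on_def)
next
  case (insert k K)
  then obtain r where r: "strict_mono r" "\<forall>k\<in>K. incseq (\<lambda>n. f (r n) k)" by blast
  obtain s where s: "strict_mono s" "incseq ((\<lambda>n. f (r n) k) \<circ> s)"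
    using nat_seq_incseq_subseq by blast
  have "incseq (\<lambda>n. f (r (s n)) l)" if "l \<in> K" for l
    using r(2) that strict_mono_less_eq[OF s(1)] by (simp add: incseq_def)
  then show ?case
    using r(1) s strict_mono_o[OF r(1) s(1)]
    by (intro exI[of _ "r \<circ> s"]) (auto simp: comp_def)
qed

lemma finite_antichain_multisets:
  fixes S :: "'k multiset set"
  assumes "finite K"
    and K: "\<And>X. X \<in> S \<Longrightarrow> set_mset X \<subseteq> K"
    and antichain: "\<And>X Y. X \<in> S \<Longrightarrow> Y \<in> S \<Longrightarrow> X \<subseteq># Y \<Longrightarrow> X = Y"
  shows "finite S"
proof (rule ccontr)
  assume "infinite S"
  then obtain g :: "nat \<Rightarrow> 'k multiset" where g: "inj g" "range g \<subseteq> S"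
    using infinite_countable_subset by blast
  obtain r where r: "strict_mono r" "\<forall>k\<in>K. incseq (\<lambda>n. count (g (r n)) k)"
    using finite_coordinates_incseq_subseq[OF assms(1), of "\<lambda>n. count (g n)"] by blast
  have "g (r 0) \<subseteq># g (r 1)"
  proof (rule mset_subset_eqI)
    fix k
    show "count (g (r 0)) k \<le> count (g (r 1)) k"
    proof (cases "k \<in> K")
      case True
      then show ?thesis using r(2) by (simp add: incseq_def)
    next
      case False
      then have "k \<notin># g (r 0)" using K g(2) by blast
      then show ?thesis by (simp add: not_in_iff)
    qed
  qed
  then have "g (r 0) = g (r 1)" using antichain g(2) by blast
  then have "r 0 = r 1" using g(1) by (simp add: inj_eq)
  then show False using strict_mono_eq[OF r(1)] by simp
qed


section \<open>Multiset inclusion and injections of positions\<close>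

lemma mset_subset_eq_iff_inj:
  "mset xs \<subseteq># mset ys \<longleftrightarrow>
    (\<exists>\<sigma>. inj_on \<sigma> {..<length xs} \<and> \<sigma> ` {..<length xs} \<subseteq> {..<length ys} \<and>
         (\<forall>i<length xs. xs ! i = ys ! \<sigma> i))" (is "_ \<longleftrightarrow> ?inj")
proof
  assume "mset xs \<subseteq># mset ys"
  then obtain zs where "mset ys = mset (xs @ zs)"
    by (metis mset_append ex_mset subset_mset.add_diff_inverse)
  then have eq: "mset (xs @ zs) = mset ys" by simp
  obtain p where p: "p permutes {..<length ys}" "permute_list p ys = xs @ zs"
    using mset_eq_permutation[OF eq] .
  have len: "length ys = length xs + length zs"
    using arg_cong[OF p(2), of length] by simp
  have "xs ! i = ys ! p i" if "i < length xs" for i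
    using permute_list_nth[OF p(1), of i] p(2) that len by (simp add: nth_append)
  moreover have "p ` {..<length xs} \<subseteq> p ` {..<length ys}" using len by (intro image_mono) simp
  ultimately show ?inj
    using permutes_inj_on[OF p(1)] permutes_image[OF p(1)] by (intro exI[of _ p]) simp
next
  assume ?inj
  then obtain \<sigma> where \<sigma>: "inj_on \<sigma> {..<length xs}" "\<sigma> ` {..<length xs} \<subseteq> {..<length ys}"
    "\<forall>i<length xs. xs ! i = ys ! \<sigma> i" by blast
  have positions: "mset zs = image_mset ((!) zs) (mset_set {..<length zs})" for zs :: "'a list"
    by (metis atLeast0LessThan map_nth mset_map mset_upt)
  have "mset xs = image_mset (\<lambda>i. ys ! \<sigma> i) (mset_set {..<length xs})"
    unfolding positions[of xs] using \<sigma>(3) by (intro image_mset_cong) simp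
  also have "\<dots> = image_mset ((!) ys) (mset_set (\<sigma> ` {..<length xs}))"
    using image_mset_mset_set[OF \<sigma>(1)] by (metis (no_types, lifting) multiset.map_comp comp_apply image_mset_cong)
  also have "\<dots> \<subseteq># image_mset ((!) ys) (mset_set {..<length ys})"
    using \<sigma>(2) by (intro image_mset_subseteq_mono subset_imp_msubset_mset_set) auto
  finally show "mset xs \<subseteq># mset ys" by (simp flip: positions)
qed

lemma mset_eq_iff_bij:
  assumes "length xs = length ys"
  shows "mset xs = mset ys \<longleftrightarrow>
    (\<exists>\<sigma>. bij_betw \<sigma> {..<length xs} {..<length xs} \<and> (\<forall>i<length xs. xs ! i = ys ! \<sigma> i))"
proof -
  have "mset xs = mset ys \<longleftrightarrow> mset xs \<subseteq># mset ys"
    using assms by (metis mset_subset_size size_mset subset_mset.le_neq_trans subset_mset.order_refl less_irrefl)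
  also have "\<dots> \<longleftrightarrow> (\<exists>\<sigma>. bij_betw \<sigma> {..<length xs} {..<length xs} \<and> (\<forall>i<length xs. xs ! i = ys ! \<sigma> i))"
    unfolding mset_subset_eq_iff_inj using assms
    by (auto simp: bij_betw_def dest: endo_inj_surj[rotated 2])
  finally show ?thesis .
qed


section \<open>Associate classes and class contents\<close>

definition assoc_class :: "('a, 'b) monoid_scheme \<Rightarrow> 'a \<Rightarrow> 'a set" where
  "assoc_class H x = {y \<in> carrier H. assoc_units H y x}"

definition content :: "('a, 'b) monoid_scheme \<Rightarrow> 'a list \<Rightarrow> 'a set multiset" where
  "content H w = mset (map (assoc_class H) w)"

lemma atoms_carrier: "atoms H \<subseteq> carrier H"
  unfolding atoms_def by blast

context monoid
begin

lemma assoc_units_refl: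
  assumes "x \<in> carrier G"
  shows "assoc_units G x x"
  unfolding assoc_units_def using assms by (intro bexI[of _ \<one>]) auto

lemma assoc_units_sym:
  assumes "assoc_units G x y" "y \<in> carrier G"
  shows "assoc_units G y x"
proof -
  obtain u v where uv: "u \<in> Units G" "v \<in> Units G" "x = u \<otimes> y \<otimes> v"
    using assms(1) unfolding assoc_units_def by blast
  have "inv u \<otimes> x \<otimes> inv v = (inv u \<otimes> u) \<otimes> y \<otimes> (v \<otimes> inv v)"
    unfolding uv(3) using uv(1,2) assms(2) by (simp add: m_assoc Units_closed del: Units_r_inv Units_l_inv)
  also have "\<dots> = y" using uv(1,2) assms(2) by (simp add: Units_closed)
  finally show ?thesis
    unfolding assoc_units_def using uv(1,2) by (metis Units_inv_Units)
qed

lemma assoc_units_trans: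
  assumes "assoc_units G x y" "assoc_units G y z" "z \<in> carrier G"
  shows "assoc_units G x z"
proof -
  obtain u v where uv: "u \<in> Units G" "v \<in> Units G" "x = u \<otimes> y \<otimes> v"
    using assms(1) unfolding assoc_units_def by blast
  obtain s t where st: "s \<in> Units G" "t \<in> Units G" "y = s \<otimes> z \<otimes> t"
    using assms(2) unfolding assoc_units_def by blast
  have "x = (u \<otimes> s) \<otimes> z \<otimes> (t \<otimes> v)"
    unfolding uv(3) st(3) using uv(1,2) st(1,2) assms(3) by (simp add: m_assoc Units_closed)
  then show ?thesis
    unfolding assoc_units_def using uv(1,2) st(1,2) by blast
qed

lemma assoc_class_eq_iff:
  assumes "x \<in> carrier G" "y \<in> carrier G"
  shows "assoc_class G x = assoc_class G y \<longleftrightarrow> assoc_units G x y"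
proof
  assume "assoc_class G x = assoc_class G y"
  then show "assoc_units G x y"
    using assoc_units_refl[OF assms(1)] assms(1) unfolding assoc_class_def by blast
next
  assume "assoc_units G x y"
  then show "assoc_class G x = assoc_class G y"
    unfolding assoc_class_def using assms assoc_units_sym assoc_units_trans by blast
qed

lemma fact_le_iff_content:
  assumes "a \<in> lists (atoms G)" "b \<in> lists (atoms G)" "a \<noteq> []"
  shows "fact_le G a b \<longleftrightarrow> word_prod G a = word_prod G b \<and> content G a \<subseteq># content G b"
proof -
  have carr: "set a \<subseteq> carrier G" "set b \<subseteq> carrier G" using assms(1,2) atoms_carrier[of G] by auto
  have "content G a \<subseteq># content G b \<longleftrightarrow>
      (\<exists>\<sigma>. inj_on \<sigma> {..<length a} \<and> \<sigma> ` {..<length a} \<subseteq> {..<length b} \<and>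
           (\<forall>i<length a. assoc_units G (a ! i) (b ! \<sigma> i)))"
    unfolding content_def mset_subset_eq_iff_inj length_map
  proof (intro ex_cong conj_cong refl all_cong)
    fix \<sigma> i
    assume "\<sigma> ` {..<length a} \<subseteq> {..<length b}" "i < length a"
    then have "\<sigma> i < length b" by blast
    then show "map (assoc_class G) a ! i = map (assoc_class G) b ! \<sigma> i \<longleftrightarrow>
        assoc_units G (a ! i) (b ! \<sigma> i)"
      using carr \<open>i < length a\<close> by (simp add: assoc_class_eq_iff subset_iff)
  qed
  moreover have "1 \<le> length b" if "content G a \<subseteq># content G b"
    using that assms(3) by (cases b) (auto simp: content_def)
  ultimately show ?thesis
    unfolding fact_le_def using assms by (auto simp: Suc_le_eq)
qed

lemma fact_cong_iff_content:
  "(a, b) \<in> fact_cong G \<longleftrightarrow> a \<in> lists (atoms G) \<and> b \<in> lists (atoms G) \<and>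
    word_prod G a = word_prod G b \<and> content G a = content G b"
proof (cases "a \<in> lists (atoms G) \<and> b \<in> lists (atoms G)")
  case True
  then have carr: "set a \<subseteq> carrier G" "set b \<subseteq> carrier G" using atoms_carrier[of G] by auto
  have len: "length a = length b" if "content G a = content G b"
    using arg_cong[OF that, of size] by (simp add: content_def)
  have perm: "content G a = content G b \<longleftrightarrow>
      (\<exists>\<sigma>. bij_betw \<sigma> {..<length a} {..<length a} \<and>
           (\<forall>i<length a. assoc_units G (a ! i) (b ! \<sigma> i)))" if "length a = length b"
    unfolding content_def mset_eq_iff_bij[of "map (assoc_class G) a" "map (assoc_class G) b",
        unfolded length_map, OF that]
  proof (intro ex_cong conj_cong refl all_cong)
    fix \<sigma> i
    assume "bij_betw \<sigma> {..<length a} {..<length a}" "i < length a"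
    then have "\<sigma> i < length b" using that by (auto dest: bij_betwE)
    then show "map (assoc_class G) a ! i = map (assoc_class G) b ! \<sigma> i \<longleftrightarrow>
        assoc_units G (a ! i) (b ! \<sigma> i)"
      using carr \<open>i < length a\<close> by (simp add: assoc_class_eq_iff subset_iff)
  qed
  show ?thesis
  proof (cases "a = []")
    case a: True
    then show ?thesis using True by (auto simp: fact_cong_def content_def)
  next
    case False
    then show ?thesis
      using True len perm unfolding fact_cong_def by (auto simp: Suc_le_eq)
  qed
next
  case False
  then show ?thesis by (auto simp: fact_cong_def)
qed


section \<open>Atoms dividing a given element\<close>

lemma word_prod_Nil: "word_prod G [] = \<one>"
  by (simp add: word_prod_def)

lemma word_prod_Cons: "word_prod G (a # w) = a \<otimes> word_prod G w"
  by (simp add: word_prod_def)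

lemma word_prod_closed: "set w \<subseteq> carrier G \<Longrightarrow> word_prod G w \<in> carrier G"
  by (induction w) (auto simp: word_prod_Nil word_prod_Cons)

lemma letter_divides_word_prod:
  assumes "set w \<subseteq> carrier G" "a \<in> set w"
  shows "divides2 G a (word_prod G w)"
proof -
  obtain p q where w: "w = p @ a # q" using assms(2) by (meson split_list)
  have app: "word_prod G (p @ q') = word_prod G p \<otimes> word_prod G q'"
    if "set p \<subseteq> carrier G" "set q' \<subseteq> carrier G" for p q'
    using that by (induction p) (auto simp: word_prod_Nil word_prod_Cons word_prod_closed m_assoc)
  have "word_prod G w = word_prod G p \<otimes> a \<otimes> word_prod G q"
    using assms(1) unfolding w by (simp add: app word_prod_Cons word_prod_closed m_assoc)
  then show ?thesis
    unfolding divides2_def using assms(1) w by (auto intro: word_prod_closed)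
qed

lemma atom_unit_mult:
  assumes "u \<in> Units G" "z \<in> carrier G" "u \<otimes> z \<in> atoms G"
  shows "z \<in> atoms G"
proof -
  have nonunit: "z \<notin> Units G" using assms(1,3) by (auto simp: atoms_def)
  have False if xy: "x \<in> carrier G - Units G" "y \<in> carrier G - Units G" "z = x \<otimes> y" for x y
  proof -
    have "u \<otimes> x \<notin> Units G"
    proof
      assume "u \<otimes> x \<in> Units G"
      then have "inv u \<otimes> (u \<otimes> x) \<in> Units G" using assms(1) by blast
      moreover have "inv u \<otimes> (u \<otimes> x) = x"
        using assms(1) xy(1) by (simp add: m_assoc[symmetric] Units_closed)
      ultimately show False using xy(1) by simp
    qed
    moreover have "u \<otimes> z = (u \<otimes> x) \<otimes> y" using xy assms(1) by (simp add: m_assoc Units_closed)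
    ultimately show False using assms(1,3) xy(1,2) by (auto simp: atoms_def)
  qed
  then show ?thesis using nonunit assms(2) unfolding atoms_def by blast
qed

text \<open>Splitting off the first letter of the product leaves two factors, one of which is a unit. If it is
  the tail, the first letter is the associate; if it is the first letter, the tail is
  again an atom, and an associate of the given one.\<close>

lemma atom_assoc_letter:
  assumes "set w \<subseteq> carrier G" "word_prod G w \<in> atoms G"
  shows "\<exists>b\<in>set w. assoc_units G (word_prod G w) b"
  using assms
proof (induction w)
  case Nil
  then show ?case by (simp add: word_prod_Nil atoms_def)
next
  case (Cons b w)
  have b: "b \<in> carrier G" and w: "set w \<subseteq> carrier G" using Cons.prems(1) by auto
  note pw = word_prod_closed[OF w]
  have prod: "b \<otimes> word_prod G w \<in> atoms G" using Cons.prems(2) by (simp add: word_prod_Cons)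
  then consider "word_prod G w \<in> Units G" | "b \<in> Units G"
    using b pw unfolding atoms_def by blast
  then show ?case
  proof cases
    case 1
    have "b \<otimes> word_prod G w = \<one> \<otimes> b \<otimes> word_prod G w" using b by simp
    then have "assoc_units G (b \<otimes> word_prod G w) b"
      unfolding assoc_units_def using 1 by blast
    then show ?thesis by (simp add: word_prod_Cons)
  next
    case 2
    have "b \<otimes> word_prod G w = b \<otimes> word_prod G w \<otimes> \<one>" using b pw by simp
    then have first: "assoc_units G (b \<otimes> word_prod G w) (word_prod G w)"
      unfolding assoc_units_def using 2 by blast
    obtain c where c: "c \<in> set w" "assoc_units G (word_prod G w) c"
      using Cons.IH[OF w atom_unit_mult[OF 2 pw prod]] by blast
    then show ?thesis
      using assoc_units_trans[OF first c(2)] w by (auto simp: word_prod_Cons)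
  qed
qed

lemma finite_assoc_classes_of_atoms:
  assumes M: "M \<subseteq> carrier G" and fgu: "fgu (G\<lparr>carrier := M\<rparr>)"
  shows "finite (assoc_class G ` (atoms G \<inter> M))"
proof -
  let ?M = "G\<lparr>carrier := M\<rparr>"
  obtain A where A: "finite A" "A \<subseteq> M"
    and gen: "M - Units ?M \<subseteq> Sgp ?M {u \<otimes> a \<otimes> v | u a v. u \<in> Units ?M \<and> a \<in> A \<and> v \<in> Units ?M}"
    using fgu unfolding fgu_def by auto
  have units: "Units ?M \<subseteq> Units G" using M by (auto simp: Units_def)
  have "assoc_class G a \<in> assoc_class G ` A" if a: "a \<in> atoms G" "a \<in> M" for a
  proof -
    have "a \<notin> Units ?M" using a(1) units by (auto simp: atoms_def)
    then have "a \<in> Sgp ?M {u \<otimes> a \<otimes> v | u a v. u \<in> Units ?M \<and> a \<in> A \<and> v \<in> Units ?M}"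
      using gen a(2) by blast
    then obtain w where "a = word_prod ?M w"
      and w: "set w \<subseteq> {u \<otimes> a \<otimes> v | u a v. u \<in> Units ?M \<and> a \<in> A \<and> v \<in> Units ?M}"
      unfolding Sgp_def by auto
    then have prod: "a = word_prod G w" by (simp add: word_prod_def)
    have letter: "\<exists>c\<in>A. assoc_units G b c" if "b \<in> set w" for b
      using w that units unfolding assoc_units_def by blast
    have wcarr: "set w \<subseteq> carrier G"
    proof
      fix b
      assume "b \<in> set w"
      then obtain u c v where "b = u \<otimes> c \<otimes> v" "u \<in> Units ?M" "c \<in> A" "v \<in> Units ?M"
        using w by blast
      moreover have "Units ?M \<subseteq> carrier G" using units Units_closed by blast
      ultimately show "b \<in> carrier G" using A(2) M by (simp add: subset_iff)
    qed
    obtain b where b: "b \<in> set w" "assoc_units G a b"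
      using atom_assoc_letter[OF wcarr] a(1) unfolding prod[symmetric] by blast
    then obtain c where c: "c \<in> A" "assoc_units G b c" using letter by blast
    have "c \<in> carrier G" "a \<in> carrier G" using c(1) A(2) a(2) M by auto
    then have "assoc_class G a = assoc_class G c"
      using assoc_units_trans[OF b(2) c(2)] by (simp add: assoc_class_eq_iff)
    then show ?thesis using c(1) by simp
  qed
  then have "assoc_class G ` (atoms G \<inter> M) \<subseteq> assoc_class G ` A" by (intro image_subsetI) simp
  then show ?thesis using A(1) by (meson finite_imageI finite_subset)
qed

lemma factorization_letters_in_div_hull:
  assumes "x \<in> carrier G" "w \<in> factorizations G x"
  shows "set w \<subseteq> div_hull G x"
proof
  fix a
  assume "a \<in> set w"
  moreover have "set w \<subseteq> carrier G" "word_prod G w = x"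
    using assms(2) atoms_carrier[of G] unfolding factorizations_def by auto
  ultimately have "divides2 G a x" "a \<in> carrier G"
    using letter_divides_word_prod by blast+
  then show "a \<in> div_hull G x"
    unfolding div_hull_def divisor_closed_def using assms(1) by blast
qed


section \<open>Minimal factorizations\<close>

lemma finite_min_factorization_classes:
  assumes x: "x \<in> carrier G" and fgu: "fgu (G\<lparr>carrier := div_hull G x\<rparr>)"
  shows "finite (min_factorization_classes G x)"
proof -
  let ?Z = "min_factorizations G x"
  let ?K = "assoc_class G ` (atoms G \<inter> div_hull G x)"
  have Z: "a \<in> lists (atoms G) \<and> word_prod G a = x" "a \<in> factorizations G x" if "a \<in> ?Z" for a
    using that unfolding min_factorizations_def factorizations_def by auto
  have "div_hull G x \<subseteq> carrier G"
    using divisor_closed_div_hull[OF monoid_axioms x] submonoid.subset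
    unfolding divisor_closed_def by blast
  then have "finite ?K" using finite_assoc_classes_of_atoms fgu by blast
  then have "finite (content G ` (?Z - {[]}))"
  proof (rule finite_antichain_multisets)
    fix X
    assume "X \<in> content G ` (?Z - {[]})"
    then obtain a where a: "a \<in> ?Z" "X = content G a" by blast
    have "set a \<subseteq> div_hull G x" using factorization_letters_in_div_hull[OF x] Z(2) a(1) by blast
    then show "set_mset X \<subseteq> ?K" using Z(1)[OF a(1)] a(2) by (auto simp: content_def)
  next
    fix X Y
    assume "X \<in> content G ` (?Z - {[]})" "Y \<in> content G ` (?Z - {[]})" and le: "X \<subseteq># Y"
    then obtain a b where a: "a \<in> ?Z" "a \<noteq> []" "X = content G a"
      and b: "b \<in> ?Z" "b \<noteq> []" "Y = content G b" by blast
    have "fact_le G a b" using fact_le_iff_content a b le Z(1) by metis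
    then have "fact_le G b a"
      using b(1) Z(1)[OF a(1)] unfolding min_factorizations_def fact_less_def by blast
    then have "Y \<subseteq># X" using fact_le_iff_content a b Z(1) by metis
    then show "X = Y" using le by simp
  qed
  then have "finite (insert {#} (content G ` (?Z - {[]})))" by simp
  then have fin: "finite (content G ` ?Z)"
    by (rule rev_finite_subset) (auto simp: content_def)
  \<comment> \<open>The congruence class of a factorization of \<open>x\<close> is recovered from its content alone.\<close>
  have "fact_cong G `` {a} = {b \<in> lists (atoms G). word_prod G b = x \<and> content G b = content G a}"
    if "a \<in> ?Z" for a
    using Z(1)[OF that] by (auto simp: fact_cong_iff_content)
  then have "min_factorization_classes G x \<subseteq>
      (\<lambda>X. {b \<in> lists (atoms G). word_prod G b = x \<and> content G b = X}) ` content G ` ?Z"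
    unfolding min_factorization_classes_def quotient_def by blast
  then show ?thesis using fin by (meson finite_imageI finite_subset)
qed

end

theorem corollary3p5:
  fixes H :: "('a, 'b) monoid_scheme"
  assumes "monoid H" and "atomic H" and "lfgu H"
  shows "FmF H"
  unfolding FmF_def
proof (intro conjI ballI)
  show "atomic H" by (fact assms(2))
next
  fix x
  assume "x \<in> carrier H"
  moreover from this have "fgu (H\<lparr>carrier := div_hull H x\<rparr>)"
    using assms(3) by (simp add: lfgu_def)
  ultimately show "finite (min_factorization_classes H x)"
    by (rule monoid.finite_min_factorization_classes[OF assms(1)])
qed

end
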